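(* Let $r\in\mathbb{N}$, $t\in\mathbb{N}_0$, and let $a_j,b_j\in\mathbb{N}_0$ and integers $c_j\ge3$ for all $j\ge1$. Then for every $n\in\mathbb{N}$: (i) If $\mathbf{s}=(\{2\}^{a_1},1,\{2\}^{b_1},c_1,\{2\}^{a_2},1,\{2\}^{b_2},c_2,\dots,\{2\}^{a_r},1,\{2\}^{b_r},c_r,\{2\}^t)$, then \[H^\star_n(\mathbf{s})=-\sum_{\mathbf{p}\in\Pi(2a_1+1,\overline{2b_1+2},\{1\}^{c_1-3},\overline{2a_2+2},\overline{2b_2+2},\{1\}^{c_2-3},\dots,\overline{2a_r+2},\overline{2b_r+2},\{1\}^{c_r-3},2t+1)}2^{\ell(\mathbf{p})}\mathcal{H}_n(\mathbf{p}).\] (ii) If $\mathbf{s}=(\{2\}^{b_1},c_1,\{2\}^{a_1},1,\dots,\{2\}^{b_r},c_r,\{2\}^{a_r},1,\{2\}^{b_{r+1}},c_{r+1},\{2\}^t)$, then \[H^\star_n(\mathbf{s})=-\sum_{\mathbf{p}\in\Pi(\overline{2b_1+2},\{1\}^{c_1-3},\overline{2a_1+2},\dots,\overline{2b_r+2},\{1\}^{c_r-3},\overline{2a_r+2},\overline{2b_{r+1}+2},\{1\}^{c_{r+1}-3},2t+1)}2^{\ell(\mathbf{p})}\mathcal{H}_n(\mathbf{p}).\]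
   Context: $\mathbb{N}=\{1,2,\dots\}$, $\mathbb{N}_0=\mathbb{N}\cup\{0\}$; for a positive integer $m$, $\overline{m}$ denotes $-m$. $\{x\}^a$ denotes $a$ consecutive copies of $x$. For $\mathbf{s}=(s_1,\dots,s_\ell)$ with nonzero integer entries, $H_n(\mathbf{s})=\sum_{n\ge k_1>\cdots>k_\ell\ge1}\prod_{i=1}^\ell \frac{\operatorname{sgn}(s_i)^{k_i}}{k_i^{|s_i|}}$ and $H^\star_n(\mathbf{s})=\sum_{n\ge k_1\ge\cdots\ge k_\ell\ge1}\prod_{i=1}^\ell \frac{\operatorname{sgn}(s_i)^{k_i}}{k_i^{|s_i|}}$, with $H_n(\mathbf{s})=0$ if $n<\ell$ and $H_n(\emptyset)=H^\star_n(\emptyset)=1$. For nonzero integers $a,b$, $a\oplus b=\operatorname{sgn}(a)b+\operatorname{sgn}(b)a$. For a sequence $(s_1,\dots,s_m)$ of nonzero integers, $\Pi(s_1,\dots,s_m)$ is the set of the $2^{m-1}$ indices $s_1\circ\cdots\circ s_m$ where each $\circ$ is independently "," or $\oplus$ (entries joined by $\oplus$ merge into one component); $\ell(\mathbf{p})$ is the number of components. For $\mathbf{p}=(p_1,\dots,p_m)$, $\mathcal{H}_n(\mathbf{p})=\sum_{k=1}^n\frac{\operatorname{sgn}(p_1)^k}{k^{|p_1|}}\frac{\binom{n}{k}}{\binom{n+k}{k}}H_{k-1}(p_2,\dots,p_m)$. *)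

theory Defs
  imports Complex_Main
begin

text \<open>
  Indices are lists of nonzero integers; a barred entry is a negative integer.
\<close>

definition mhs_term :: "int list \<Rightarrow> nat list \<Rightarrow> real" where
  "mhs_term s ks = (\<Prod>i<length s. of_int (sgn (s ! i)) ^ (ks ! i) / of_nat (ks ! i) ^ nat \<bar>s ! i\<bar>)"

definition mhs :: "nat \<Rightarrow> int list \<Rightarrow> real" where
  "mhs n s = (\<Sum>ks | length ks = length s \<and> set ks \<subseteq> {1..n} \<and> sorted_wrt (>) ks. mhs_term s ks)"

definition mhs_star :: "nat \<Rightarrow> int list \<Rightarrow> real" where
  "mhs_star n s = (\<Sum>ks | length ks = length s \<and> set ks \<subseteq> {1..n} \<and> sorted_wrt (\<ge>) ks. mhs_term s ks)"

definition oplus :: "int \<Rightarrow> int \<Rightarrow> int" where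
  "oplus a b = sgn a * b + sgn b * a"

text \<open>
  The two parts of the union in the last equation correspond to choosing a comma, respectively
  \<^const>\<open>oplus\<close>, between the first two entries. The value at the empty list is a convention
  that is never used.
\<close>

fun merge_set :: "int list \<Rightarrow> int list set" where
  "merge_set [] = {[]}"
| "merge_set [x] = {[x]}"
| "merge_set (x # y # s) = (#) x ` merge_set (y # s) \<union> merge_set (oplus x y # s)"

lemma finite_merge_set: "finite (merge_set s)"
  by (induction s rule: merge_set.induct) auto

lemma abs_oplus: "x \<noteq> 0 \<Longrightarrow> y \<noteq> 0 \<Longrightarrow> \<bar>oplus x y\<bar> = \<bar>x\<bar> + \<bar>y\<bar>"
  by (auto simp: oplus_def sgn_if)

lemma abs_hd_merge_set:
  "p \<in> merge_set (x # s) \<Longrightarrow> 0 \<notin> set (x # s) \<Longrightarrow> p \<noteq> [] \<and> \<bar>x\<bar> \<le> \<bar>hd p\<bar>"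
proof (induction s arbitrary: x p)
  case (Cons y s)
  have nz: "x \<noteq> 0" "y \<noteq> 0" "0 \<notin> set s" using Cons.prems(2) by auto
  have "oplus x y \<noteq> 0" using abs_oplus[OF nz(1,2)] nz by linarith
  with Cons.prems(1) Cons.IH[of p "oplus x y"] abs_oplus[OF nz(1,2)] nz show ?case by auto
qed auto

lemma card_merge_set:
  "s \<noteq> [] \<Longrightarrow> 0 \<notin> set s \<Longrightarrow> card (merge_set s) = 2 ^ (length s - 1)"
proof (induction s rule: merge_set.induct)
  case (3 x y s)
  have nz: "x \<noteq> 0" "y \<noteq> 0" "0 \<notin> set s" using 3(4) by auto
  have o: "oplus x y \<noteq> 0" using abs_oplus[OF nz(1,2)] nz by linarith
  have "(#) x ` merge_set (y # s) \<inter> merge_set (oplus x y # s) = {}"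
    using abs_hd_merge_set[of _ "oplus x y" s] abs_oplus[OF nz(1,2)] o nz by fastforce
  then show ?case using 3(1,2) o nz
    by (simp add: card_Un_disjoint finite_merge_set card_image)
qed auto

text \<open>The binomial multiple harmonic sum; it is only meaningful for nonempty indices.\<close>

primrec (nonexhaustive) binom_mhs :: "nat \<Rightarrow> int list \<Rightarrow> real" where
  "binom_mhs n (p # ps) =
     (\<Sum>k=1..n. of_int (sgn p) ^ k / of_nat k ^ nat \<bar>p\<bar>
        * (of_nat (n choose k) / of_nat ((n + k) choose k)) * mhs (k - 1) ps)"

end

theory Submission
  imports Defs
begin

text \<open>
  Let \<open>x\<^bsub>n,k\<^esub>\<close> be the quotient of the two binomial coefficients and
  \<open>L\<^sub>n f = (\<Sum>k=1..n. x\<^bsub>n,k\<^esub> * f k)\<close>. Summing over \<open>merge_set q\<close> with weight \<open>2 ^ length p\<close> replaces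
  strict by weak inequalities between the summation indices, so the right-hand sides are
  \<open>- L\<^sub>n (T q)\<close>, where prepending an entry to \<open>q\<close> applies
  \<open>A f k = f k + 2 * (\<Sum>j<k. f j)\<close> and then multiplies by a power of \<open>k\<close> and a sign.

  On the left, prepending \<open>s\<close> to the index means \<open>u\<^sub>n \<mapsto> (\<Sum>m=1..n. u\<^sub>m / m ^ s)\<close>. Three identities, which
  telescope by \<open>(n+k+1) x\<^bsub>n,k+1\<^esub> = (n-k) x\<^bsub>n,k\<^esub>\<close> and \<open>x\<^bsub>n,k\<^esub> - x\<^bsub>n-1,k\<^esub> = x\<^bsub>n,k\<^esub> k\<^sup>2 / n\<^sup>2\<close>, transport
  this to \<open>f\<close>: the map for \<open>s = 2\<close> is division of \<open>f\<close> by \<open>k\<^sup>2\<close>; multiplying \<open>L\<^sub>n f\<close> by \<open>n\<close> is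
  \<open>f \<mapsto> k * A f\<close>; dividing it by \<open>n\<close> is \<open>f \<mapsto> (-1)^k * A ((-1)^j * f j / j)\<close>. The entries \<open>1\<close> and
  \<open>c \<ge> 3\<close> come from combining the first with one of the other two.
\<close>

section \<open>Signed powers and the recursion for harmonic sums\<close>

definition sgn_pow :: "int \<Rightarrow> nat \<Rightarrow> real" where
  "sgn_pow p k = of_int (sgn p) ^ k / of_nat k ^ nat \<bar>p\<bar>"

lemma sgn_pow_oplus:
  assumes "x \<noteq> 0" "y \<noteq> 0"
  shows "sgn_pow (oplus x y) k = sgn_pow x k * sgn_pow y k"
proof -
  have "sgn (oplus x y) = sgn x * sgn y"
    using assms by (auto simp: oplus_def sgn_if)
  moreover have "nat \<bar>oplus x y\<bar> = nat \<bar>x\<bar> + nat \<bar>y\<bar>"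
    using assms by (simp add: abs_oplus nat_add_distrib)
  ultimately show ?thesis
    by (simp add: sgn_pow_def power_add power_mult_distrib)
qed

lemma sgn_pow_odd: "sgn_pow (2 * int a + 1) k = 1 / real k ^ (2 * a + 1)"
proof -
  have "nat (2 * int a + 1) = 2 * a + 1" by simp
  then show ?thesis by (simp add: sgn_pow_def)
qed

lemma sgn_pow_bar_even: "sgn_pow (- (2 * int b + 2)) k = (-1) ^ k / real k ^ (2 * b + 2)"
proof -
  have "sgn (- (2 * int b + 2)) = -1" "nat \<bar>- (2 * int b + 2)\<bar> = 2 * b + 2" by simp_all
  then show ?thesis by (simp only: sgn_pow_def of_int_minus of_int_1)
qed

lemma mhs_term_Cons: "mhs_term (x # s) (k # ks) = sgn_pow x k * mhs_term s ks"
  by (simp add: mhs_term_def sgn_pow_def prod.lessThan_Suc_shift del: prod.lessThan_Suc)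

lemma finite_lists_upto: "finite {ks. length ks = l \<and> set ks \<subseteq> {1..n::nat} \<and> P ks}"
  by (rule finite_subset[OF _ finite_lists_length_eq[of "{1..n}" l]]) auto

text \<open>Splits off the largest index \<open>k\<close>, which leaves the bound \<open>g k\<close>
  for the others. Strict and weak orders are both covered, by \<open>g k = k - 1\<close> and
  \<open>g k = k\<close>.\<close>

lemma sum_sorted_lists_Suc:
  fixes F :: "nat list \<Rightarrow> real"
  assumes R: "\<And>k j. 1 \<le> k \<Longrightarrow> 1 \<le> j \<Longrightarrow> R k j \<longleftrightarrow> j \<le> g k" and g: "\<And>k. g k \<le> k"
  shows "(\<Sum>ks | length ks = Suc l \<and> set ks \<subseteq> {1..n} \<and> sorted_wrt R ks. F ks)
       = (\<Sum>k=1..n. \<Sum>ks | length ks = l \<and> set ks \<subseteq> {1..g k} \<and> sorted_wrt R ks. F (k # ks))"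
    (is "sum F ?A = (\<Sum>k=1..n. sum _ (?B k))")
proof -
  have "(\<Sum>k=1..n. \<Sum>ks\<in>?B k. F (k # ks)) = (\<Sum>(k, ks)\<in>Sigma {1..n} ?B. F (k # ks))"
    by (rule sum.Sigma) (simp, intro ballI finite_lists_upto)
  also have "\<dots> = sum F ?A"
  proof (rule sum.reindex_bij_witness[where i = "\<lambda>ks. (hd ks, tl ks)" and j = "\<lambda>(k, ks). k # ks"],
         goal_cases)
    case (1 p)
    then show ?case by (cases p) simp
  next
    case (2 p)
    then obtain k ks where p: "p = (k, ks)" "k \<in> {1..n}" "ks \<in> ?B k" by blast
    have "j \<in> {1..n} \<and> R k j" if "j \<in> set ks" for j
    proof -
      have "1 \<le> j" "j \<le> g k" using p(3) that by auto
      then show ?thesis using R[of k j] g[of k] p(2) by simp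
    qed
    then show ?case using p by auto
  next
    case (3 ks)
    then show ?case by (cases ks) simp_all
  next
    case (4 ks)
    then obtain k js where ks: "ks = k # js" by (cases ks) auto
    have "j \<in> {1..g k}" if "j \<in> set js" for j
      using 4 that R[of k j] unfolding ks by auto
    then show ?case using 4 unfolding ks by auto
  next
    case (5 p)
    then show ?case by (cases p) simp
  qed
  finally show ?thesis ..
qed

lemma mhs_Nil: "mhs n [] = 1"
proof -
  have "{ks::nat list. length ks = length [] \<and> set ks \<subseteq> {1..n} \<and> sorted_wrt (>) ks} = {[]}"
    by auto
  then show ?thesis by (simp add: mhs_def mhs_term_def)
qed

lemma mhs_star_Nil: "mhs_star n [] = 1"
proof -
  have "{ks::nat list. length ks = length [] \<and> set ks \<subseteq> {1..n} \<and> sorted_wrt (\<ge>) ks} = {[]}"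
    by auto
  then show ?thesis by (simp add: mhs_star_def mhs_term_def)
qed

lemma mhs_Cons: "mhs n (x # s) = (\<Sum>k=1..n. sgn_pow x k * mhs (k - 1) s)"
  unfolding mhs_def list.size add_Suc_right add_0_right
  by (subst sum_sorted_lists_Suc[where g = "\<lambda>k. k - 1"])
     (auto simp: mhs_term_Cons sum_distrib_left)

lemma mhs_star_Cons: "mhs_star n (x # s) = (\<Sum>k=1..n. sgn_pow x k * mhs_star k s)"
  unfolding mhs_star_def list.size add_Suc_right add_0_right
  by (subst sum_sorted_lists_Suc[where g = "\<lambda>k. k"])
     (auto simp: mhs_term_Cons sum_distrib_left)

section \<open>The weighted sum over all merged indices\<close>

definition accum :: "(nat \<Rightarrow> real) \<Rightarrow> nat \<Rightarrow> real" where
  "accum f k = f k + 2 * (\<Sum>j=1..k-1. f j)"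

text \<open>The 2 at the last entry is the factor of the component containing that entry; each comma
  contributes a further 2 through \<open>accum\<close>.\<close>

primrec merge_weight :: "int list \<Rightarrow> nat \<Rightarrow> real" where
  "merge_weight [] k = 0"
| "merge_weight (x # s) k = sgn_pow x k * (if s = [] then 2 else accum (merge_weight s) k)"

lemma merge_weight_Cons:
  "s \<noteq> [] \<Longrightarrow> merge_weight (x # s) k = sgn_pow x k * accum (merge_weight s) k"
  by simp

lemma accum_cong:
  assumes "k \<ge> 1" "\<And>j. j \<ge> 1 \<Longrightarrow> f j = g j"
  shows "accum f k = accum g k"
  using assms by (auto simp: accum_def intro!: sum.cong)

text \<open>A comma after the first entry adds a component, hence a factor 2, and lets the next
  index run over \<open>j < k\<close>. Merging forces both entries to share \<open>k\<close>, where
  \<open>sgn_pow\<close> is multiplicative. Together this is \<open>accum\<close>.\<close>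

lemma sum_merge_set:
  assumes "0 \<notin> set q" "q \<noteq> []"
  shows "(\<Sum>p\<in>merge_set q. 2 ^ length p * (sgn_pow (hd p) k * mhs (k - 1) (tl p)))
       = merge_weight q k"
  using assms
proof (induction q arbitrary: k rule: merge_set.induct)
  case (2 x)
  then show ?case by (simp add: mhs_Nil)
next
  case (3 x y s)
  let ?F = "\<lambda>k p. 2 ^ length p * (sgn_pow (hd p) k * mhs (k - 1) (tl p))"
  have nz: "x \<noteq> 0" "y \<noteq> 0" "0 \<notin> set s" using 3 by auto
  have o: "oplus x y \<noteq> 0" using abs_oplus[OF nz(1,2)] nz by linarith
  \<comment> \<open>Heads in the second set have absolute value at least |x| + |y| > |x|.\<close>
  have disj: "(#) x ` merge_set (y # s) \<inter> merge_set (oplus x y # s) = {}"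
    using abs_hd_merge_set[of _ "oplus x y" s] abs_oplus[OF nz(1,2)] o nz by fastforce
  have unfold_mhs: "mhs (k - 1) p = (\<Sum>j=1..k-1. sgn_pow (hd p) j * mhs (j - 1) (tl p))"
    if "p \<in> merge_set (y # s)" for p
    using abs_hd_merge_set[OF that] nz mhs_Cons[of "k - 1" "hd p" "tl p"] by auto
  have "(\<Sum>p\<in>(#) x ` merge_set (y # s). ?F k p)
      = (\<Sum>p\<in>merge_set (y # s). 2 * 2 ^ length p * (sgn_pow x k * mhs (k - 1) p))"
    by (subst sum.reindex) auto
  also have "\<dots> = (\<Sum>p\<in>merge_set (y # s). \<Sum>j=1..k-1. 2 * sgn_pow x k * ?F j p)"
    by (rule sum.cong) (use unfold_mhs in \<open>simp_all add: sum_distrib_left mult_ac\<close>)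
  also have "\<dots> = (\<Sum>j=1..k-1. \<Sum>p\<in>merge_set (y # s). 2 * sgn_pow x k * ?F j p)"
    by (rule sum.swap)
  also have "\<dots> = sgn_pow x k * (2 * (\<Sum>j=1..k-1. merge_weight (y # s) j))"
    using 3 nz by (simp add: sum_distrib_left[symmetric] mult_ac del: merge_weight.simps)
  finally have comma: "(\<Sum>p\<in>(#) x ` merge_set (y # s). ?F k p)
      = sgn_pow x k * (2 * (\<Sum>j=1..k-1. merge_weight (y # s) j))" .
  have merge: "(\<Sum>p\<in>merge_set (oplus x y # s). ?F k p) = sgn_pow x k * merge_weight (y # s) k"
    using 3 nz o by (simp add: sgn_pow_oplus)
  have "(\<Sum>p\<in>merge_set (x # y # s). ?F k p)
      = sgn_pow x k * (2 * (\<Sum>j=1..k-1. merge_weight (y # s) j)) + sgn_pow x k * merge_weight (y # s) k"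
    unfolding merge_set.simps
    by (subst sum.union_disjoint[OF _ _ disj])
       (simp_all only: comma merge finite_merge_set finite_imageI)
  then show ?case
    by (simp add: merge_weight_Cons accum_def algebra_simps del: merge_weight.simps)
qed simp

section \<open>Recurrences for the binomial quotient\<close>

definition binom_ratio :: "nat \<Rightarrow> nat \<Rightarrow> real" where
  "binom_ratio n k = of_nat (n choose k) / of_nat ((n + k) choose k)"

definition binom_sum :: "nat \<Rightarrow> (nat \<Rightarrow> real) \<Rightarrow> real" where
  "binom_sum n f = (\<Sum>k=1..n. binom_ratio n k * f k)"

lemma binom_sum_cong:
  "(\<And>k. k \<ge> 1 \<Longrightarrow> f k = g k) \<Longrightarrow> binom_sum n f = binom_sum n g"
  by (simp add: binom_sum_def)

lemma sum_merge_set_binom_mhs: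
  assumes "0 \<notin> set q" "q \<noteq> []"
  shows "(\<Sum>p\<in>merge_set q. 2 ^ length p * binom_mhs n p) = binom_sum n (merge_weight q)"
proof -
  let ?F = "\<lambda>k p. 2 ^ length p * (sgn_pow (hd p) k * mhs (k - 1) (tl p))"
  have ne: "p \<noteq> []" if "p \<in> merge_set q" for p
    using assms that by (cases q) (auto dest: abs_hd_merge_set)
  have "(\<Sum>p\<in>merge_set q. 2 ^ length p * binom_mhs n p)
      = (\<Sum>p\<in>merge_set q. \<Sum>k=1..n. binom_ratio n k * ?F k p)"
  proof (rule sum.cong)
    fix p assume "p \<in> merge_set q"
    then obtain x s where "p = x # s" using ne by (cases p) auto
    then show "2 ^ length p * binom_mhs n p = (\<Sum>k=1..n. binom_ratio n k * ?F k p)"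
      by (simp add: sgn_pow_def binom_ratio_def sum_distrib_left mult_ac)
  qed simp
  also have "\<dots> = (\<Sum>k=1..n. \<Sum>p\<in>merge_set q. binom_ratio n k * ?F k p)"
    by (rule sum.swap)
  also have "\<dots> = binom_sum n (merge_weight q)"
    unfolding sum_distrib_left[symmetric] sum_merge_set[OF assms] binom_sum_def ..
  finally show ?thesis .
qed

lemma binom_ratio_0: "binom_ratio n 0 = 1"
  by (simp add: binom_ratio_def)

lemma binom_ratio_eq_0: "n < k \<Longrightarrow> binom_ratio n k = 0"
  by (simp add: binom_ratio_def)

lemma binom_ratio_Suc_right:
  assumes "k \<le> n"
  shows "(real n + real k + 1) * binom_ratio n (Suc k) = (real n - real k) * binom_ratio n k"
proof -
  have "Suc k * (n choose Suc k) = (n - k) * (n choose k)"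
    by (simp only: binomial_absorption binomial_absorb_comp)
  then have 1: "real (Suc k) * real (n choose Suc k) = (real n - real k) * real (n choose k)"
    using assms by (metis of_nat_diff of_nat_mult)
  have 2: "real (Suc k) * real ((n + Suc k) choose Suc k) = (real n + real k + 1) * real ((n + k) choose k)"
    using arg_cong[OF Suc_times_binomial[of k "n + k"], of real]
    by (simp add: algebra_simps del: binomial_Suc_Suc)
  have pos: "real ((n + Suc k) choose Suc k) > 0" "real ((n + k) choose k) > 0"
    by (simp_all del: binomial_Suc_Suc)
  have "(real n + real k + 1) * real (n choose Suc k) * real ((n + k) choose k)
      = real (Suc k) * real (n choose Suc k) * real ((n + Suc k) choose Suc k)"
    using 2 by (simp add: mult_ac)
  also have "\<dots> = (real n - real k) * real (n choose k) * real ((n + Suc k) choose Suc k)"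
    using 1 by simp
  finally show ?thesis
    using pos unfolding binom_ratio_def by (simp add: field_simps del: binomial_Suc_Suc)
qed

text \<open>The difference formula in \<open>n\<close>, cross-multiplied so that it also covers
  \<open>k = Suc n\<close>, where the factor on the left vanishes.\<close>

lemma binom_ratio_Suc_left:
  "binom_ratio (Suc n) k * ((real n + 1)\<^sup>2 - (real k)\<^sup>2) = binom_ratio n k * (real n + 1)\<^sup>2"
proof (cases "k \<le> n")
  case True
  have 1: "(real n + 1 - real k) * real (Suc n choose k) = (real n + 1) * real (n choose k)"
    using arg_cong[OF binomial_absorb_comp[of "Suc n" k], of real] True
    by (simp add: of_nat_diff add.commute del: of_nat_Suc binomial_Suc_Suc) (simp add: algebra_simps)
  have 2: "(real n + 1) * real ((Suc n + k) choose k) = (real n + real k + 1) * real ((n + k) choose k)"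
    using arg_cong[OF binomial_absorb_comp[of "Suc n + k" k], of real]
    by (simp add: algebra_simps)
  have pos: "real ((Suc n + k) choose k) > 0" "real ((n + k) choose k) > 0" by simp_all
  have "real (Suc n choose k) * ((real n + 1)\<^sup>2 - (real k)\<^sup>2) * real ((n + k) choose k)
     = ((real n + 1 - real k) * real (Suc n choose k)) * ((real n + real k + 1) * real ((n + k) choose k))"
    by (simp add: power2_eq_square algebra_simps)
  also have "\<dots> = real (n choose k) * (real n + 1)\<^sup>2 * real ((Suc n + k) choose k)"
    unfolding 1 2[symmetric] by (simp add: power2_eq_square)
  finally show ?thesis
    using pos unfolding binom_ratio_def
    by (simp add: field_simps del: binomial_Suc_Suc add_Suc)
next
  case False
  then show ?thesis
    by (cases "k = Suc n") (simp_all add: binom_ratio_eq_0)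
qed

section \<open>The three transport identities\<close>

lemma binom_sum_div_square:
  "(\<Sum>m=1..n. binom_sum m f / (real m)\<^sup>2) = binom_sum n (\<lambda>k. f k / (real k)\<^sup>2)"
proof (induction n)
  case (Suc n)
  \<comment> \<open>The added term \<open>k = Suc n\<close> is zero; both sums now have the same
    range and can be compared termwise.\<close>
  have extend: "binom_sum n (\<lambda>k. f k / (real k)\<^sup>2) = (\<Sum>k=1..Suc n. binom_ratio n k * (f k / (real k)\<^sup>2))"
    by (simp add: binom_sum_def binom_ratio_eq_0)
  have step: "binom_ratio n k * (f k / (real k)\<^sup>2) + binom_ratio (Suc n) k * f k / (real (Suc n))\<^sup>2
      = binom_ratio (Suc n) k * (f k / (real k)\<^sup>2)" if "k \<ge> 1" for k
  proof -
    have "binom_ratio n k = binom_ratio (Suc n) k * ((real n + 1)\<^sup>2 - (real k)\<^sup>2) / (real n + 1)\<^sup>2"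
      unfolding binom_ratio_Suc_left by simp
    also have "\<dots> = binom_ratio (Suc n) k * (1 - (real k)\<^sup>2 / (real (Suc n))\<^sup>2)"
      by (simp add: diff_divide_distrib right_diff_distrib add.commute)
    finally have "binom_ratio n k * (f k / (real k)\<^sup>2) + binom_ratio (Suc n) k * f k / (real (Suc n))\<^sup>2
        = binom_ratio (Suc n) k * f k
            * ((1 - (real k)\<^sup>2 / (real (Suc n))\<^sup>2) / (real k)\<^sup>2 + 1 / (real (Suc n))\<^sup>2)"
      by (simp add: distrib_left del: of_nat_Suc)
    also have "(1 - (real k)\<^sup>2 / (real (Suc n))\<^sup>2) / (real k)\<^sup>2 + 1 / (real (Suc n))\<^sup>2 = 1 / (real k)\<^sup>2"
      using that by (simp add: diff_divide_distrib del: of_nat_Suc)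
    finally show ?thesis by simp
  qed
  have "(\<Sum>m=1..Suc n. binom_sum m f / (real m)\<^sup>2)
      = binom_sum n (\<lambda>k. f k / (real k)\<^sup>2) + binom_sum (Suc n) f / (real (Suc n))\<^sup>2"
    using Suc by simp
  also have "\<dots> = (\<Sum>k=1..Suc n. binom_ratio n k * (f k / (real k)\<^sup>2)
      + binom_ratio (Suc n) k * f k / (real (Suc n))\<^sup>2)"
    unfolding extend by (simp only: binom_sum_def sum_divide_distrib sum.distrib)
  also have "\<dots> = binom_sum (Suc n) (\<lambda>k. f k / (real k)\<^sup>2)"
    unfolding binom_sum_def by (rule sum.cong) (use step in auto)
  finally show ?case .
qed (simp add: binom_sum_def)

text \<open>In the double sum \<open>f j\<close> occurs once for \<open>k = j\<close> and twice for
  each \<open>k > j\<close>. This reduces the identities for \<open>accum\<close> to tail sums of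
  \<open>u\<close>.\<close>

lemma sum_mult_accum:
  "(\<Sum>k=1..n. u k * accum f k) = (\<Sum>j=1..n. (u j + 2 * (\<Sum>k=Suc j..n. u k)) * f j)"
proof (induction n)
  case (Suc n)
  have "(\<Sum>j=1..Suc n. (u j + 2 * (\<Sum>k=Suc j..Suc n. u k)) * f j)
      = (\<Sum>j=1..n. (u j + 2 * (\<Sum>k=Suc j..n. u k)) * f j + 2 * u (Suc n) * f j) + u (Suc n) * f (Suc n)"
    by (auto simp: algebra_simps intro!: sum.cong)
  also have "\<dots> = (\<Sum>k=1..Suc n. u k * accum f k)"
    using Suc by (simp add: sum.distrib accum_def sum_distrib_left algebra_simps)
  finally show ?case ..
qed simp

text \<open>Downward induction from \<open>j = n\<close>, where both sides vanish. In the step the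
  coefficients of \<open>binom_ratio n (Suc j)\<close> add up to 2(j+1) + (n-j-1) = n+j+1, as
  \<open>binom_ratio_Suc_right\<close> requires.\<close>

lemma binom_ratio_tail_sum:
  assumes "j \<le> n"
  shows "2 * (\<Sum>k=Suc j..n. real k * binom_ratio n k) = (real n - real j) * binom_ratio n j"
  using assms
proof (induction j rule: inc_induct)
  case (step j)
  have "(\<Sum>k=Suc j..n. real k * binom_ratio n k)
      = real (Suc j) * binom_ratio n (Suc j) + (\<Sum>k=Suc (Suc j)..n. real k * binom_ratio n k)"
    using step by (intro sum.atLeast_Suc_atMost) simp
  then show ?case
    using step binom_ratio_Suc_right[of j n] by (simp add: algebra_simps)
qed simp

text \<open>The same induction; up to sign the coefficients now combine to 2n - (n-j-1) =
  n+j+1.\<close>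

lemma binom_ratio_alternating_tail_sum:
  assumes "j \<le> n"
  shows "2 * real n * (\<Sum>k=Suc j..n. (-1) ^ k * binom_ratio n k)
       = - ((-1) ^ j * (real n - real j) * binom_ratio n j)"
  using assms
proof (induction j rule: inc_induct)
  case (step j)
  have "(\<Sum>k=Suc j..n. (-1) ^ k * binom_ratio n k)
      = (-1) ^ Suc j * binom_ratio n (Suc j) + (\<Sum>k=Suc (Suc j)..n. (-1) ^ k * binom_ratio n k)"
    using step by (intro sum.atLeast_Suc_atMost) simp
  then have "2 * real n * (\<Sum>k=Suc j..n. (-1) ^ k * binom_ratio n k)
      = - ((-1) ^ j * ((real n + real j + 1) * binom_ratio n (Suc j)))"
    by (simp only: distrib_left step.IH) (simp add: algebra_simps)
  then show ?case
    using step binom_ratio_Suc_right[of j n] by simp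
qed simp

text \<open>By the tail sum, \<open>f j\<close> receives the coefficient j + (n-j) = n times
  \<open>binom_ratio n j\<close>.\<close>

lemma binom_sum_times: "real n * binom_sum n f = binom_sum n (\<lambda>k. real k * accum f k)"
proof -
  have "binom_sum n (\<lambda>k. real k * accum f k) = (\<Sum>k=1..n. (real k * binom_ratio n k) * accum f k)"
    by (simp add: binom_sum_def mult_ac)
  also have "\<dots> = (\<Sum>j=1..n. real n * (binom_ratio n j * f j))"
    unfolding sum_mult_accum
    by (intro sum.cong) (auto simp: binom_ratio_tail_sum algebra_simps)
  finally show ?thesis by (simp add: binom_sum_def sum_distrib_left)
qed

definition alt_accum :: "(nat \<Rightarrow> real) \<Rightarrow> nat \<Rightarrow> real" where
  "alt_accum f k = (-1) ^ k * accum (\<lambda>j. (-1) ^ j * f j / real j) k"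

text \<open>After multiplication by \<open>n\<close> the alternating tail sum leaves n - (n-j) = j,
  which cancels the division by \<open>j\<close> in \<open>alt_accum\<close>; the two signs cancel
  as well.\<close>

lemma binom_sum_eq_times_alt_accum: "binom_sum n f = real n * binom_sum n (alt_accum f)"
proof -
  have coeff: "real n * (((-1) ^ j * binom_ratio n j + 2 * (\<Sum>k=Suc j..n. (-1) ^ k * binom_ratio n k))
      * ((-1) ^ j * f j / real j)) = binom_ratio n j * f j" if "j \<in> {1..n}" for j
  proof -
    have "real n * ((-1) ^ j * binom_ratio n j + 2 * (\<Sum>k=Suc j..n. (-1) ^ k * binom_ratio n k))
        = real n * (-1) ^ j * binom_ratio n j + 2 * real n * (\<Sum>k=Suc j..n. (-1) ^ k * binom_ratio n k)"
      by (simp add: algebra_simps)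
    also have "\<dots> = real j * (-1) ^ j * binom_ratio n j"
      using that binom_ratio_alternating_tail_sum[of j n] by (simp add: algebra_simps)
    finally show ?thesis
      using that by (simp add: mult.assoc[symmetric])
  qed
  have "binom_sum n (alt_accum f)
      = (\<Sum>k=1..n. ((-1) ^ k * binom_ratio n k) * accum (\<lambda>j. (-1) ^ j * f j / real j) k)"
    by (simp add: binom_sum_def alt_accum_def mult_ac)
  then show ?thesis
    unfolding sum_mult_accum using coeff by (simp add: sum_distrib_left binom_sum_def)
qed

lemma binom_sum_eq_power_times_alt_accum:
  "binom_sum n f = real n ^ i * binom_sum n ((alt_accum ^^ i) f)"
proof (induction i)
  case (Suc i)
  then show ?case
    using binom_sum_eq_times_alt_accum[of n "(alt_accum ^^ i) f"] by simp
qed simp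

section \<open>Representing star sums by binomial sums\<close>

text \<open>The case \<open>n = 0\<close> is left out because \<open>mhs_star 0 [] = 1\<close>, while \<open>binom_sum 0 f = 0\<close>.\<close>

definition represents :: "(nat \<Rightarrow> real) \<Rightarrow> int list \<Rightarrow> bool" where
  "represents f s \<longleftrightarrow> (\<forall>n\<ge>1. mhs_star n s = - binom_sum n f)"

lemma represents_cong:
  "represents f s \<Longrightarrow> (\<And>k. k \<ge> 1 \<Longrightarrow> f k = g k) \<Longrightarrow> represents g s"
  using binom_sum_cong[of f g] by (simp add: represents_def)

text \<open>The alternating tail sum at \<open>j = 0\<close>, where the quotient is 1.\<close>

lemma represents_Nil: "represents (\<lambda>k. 2 * (-1) ^ k) []"
proof -
  have "binom_sum n (\<lambda>k. 2 * (-1) ^ k) = -1" if "n \<ge> 1" for n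
  proof -
    have "real n * binom_sum n (\<lambda>k. 2 * (-1) ^ k)
        = 2 * real n * (\<Sum>k=Suc 0..n. (-1) ^ k * binom_ratio n k)"
      by (simp add: binom_sum_def sum_distrib_left mult_ac)
    also have "\<dots> = real n * (-1)"
      using binom_ratio_alternating_tail_sum[of 0 n] by (simp add: binom_ratio_0)
    finally show ?thesis using that by (subst (asm) mult_left_cancel) auto
  qed
  then show ?thesis by (simp add: represents_def mhs_star_Nil)
qed

text \<open>The factor 1/m^2 is handled by \<open>binom_sum_div_square\<close>; passing from
  \<open>f\<close> to \<open>g\<close> absorbs what remains of \<open>sgn_pow c m\<close>.\<close>

lemma represents_ConsI:
  assumes "represents f s"
    and "\<And>m. m \<ge> 1 \<Longrightarrow> sgn_pow c m * binom_sum m f = binom_sum m g / (real m)\<^sup>2"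
  shows "represents (\<lambda>k. g k / (real k)\<^sup>2) (c # s)"
  unfolding represents_def
proof (intro allI impI)
  fix n :: nat
  have "mhs_star n (c # s) = (\<Sum>m=1..n. - (binom_sum m g / (real m)\<^sup>2))"
    unfolding mhs_star_Cons using assms by (intro sum.cong) (auto simp: represents_def)
  also have "\<dots> = - binom_sum n (\<lambda>k. g k / (real k)\<^sup>2)"
    unfolding sum_negf binom_sum_div_square ..
  finally show "mhs_star n (c # s) = - binom_sum n (\<lambda>k. g k / (real k)\<^sup>2)" .
qed

lemma represents_Cons_2: "represents f s \<Longrightarrow> represents (\<lambda>k. f k / (real k)\<^sup>2) (2 # s)"
  by (rule represents_ConsI) (auto simp: sgn_pow_def)

lemma represents_replicate_2:
  "represents f s \<Longrightarrow> represents (\<lambda>k. f k / real k ^ (2 * m)) (replicate m 2 @ s)"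
proof (induction m)
  case (Suc m)
  from represents_Cons_2[OF Suc.IH[OF Suc.prems]] show ?case
    by (simp add: power2_eq_square mult_ac)
qed simp

lemma represents_Cons_1:
  assumes "represents f s"
  shows "represents (\<lambda>k. accum f k / real k) (1 # s)"
proof -
  have "represents (\<lambda>k. real k * accum f k / (real k)\<^sup>2) (1 # s)"
    by (rule represents_ConsI[OF assms])
       (simp add: binom_sum_times[symmetric] sgn_pow_def power2_eq_square)
  then show ?thesis by (rule represents_cong) (simp add: power2_eq_square)
qed

lemma represents_Cons_ge_2:
  assumes "represents f s"
  shows "represents (\<lambda>k. (alt_accum ^^ i) f k / (real k)\<^sup>2) ((int i + 2) # s)"
proof (rule represents_ConsI[OF assms])
  fix m :: nat assume "m \<ge> 1"
  then show "sgn_pow (int i + 2) m * binom_sum m f = binom_sum m ((alt_accum ^^ i) f) / (real m)\<^sup>2"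
    using binom_sum_eq_power_times_alt_accum[of m f i]
    by (simp add: sgn_pow_def nat_add_distrib power_add power2_eq_square)
qed

section \<open>Blocks of the index\<close>

text \<open>The first application of \<open>alt_accum\<close> removes the factor
  \<open>(-1)^k * k\<close> and only yields \<open>accum\<close>. Each later one divides by the
  index, which prepends an entry 1.\<close>

lemma alt_accum_power_merge_weight:
  assumes "q \<noteq> []" "k \<ge> 1"
  shows "(alt_accum ^^ Suc i) (\<lambda>k. (-1) ^ k * real k * merge_weight q k) k
       = (-1) ^ k * accum (merge_weight (replicate i 1 @ q)) k"
  using assms(2)
proof (induction i arbitrary: k)
  case 0
  then show ?case
    by (auto simp: alt_accum_def mult.assoc[symmetric] simp flip: power_mult_distrib intro!: accum_cong)
next
  case (Suc i)
  have "(alt_accum ^^ Suc (Suc i)) (\<lambda>k. (-1) ^ k * real k * merge_weight q k) k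
      = (-1) ^ k * accum (\<lambda>j. (-1) ^ j * (alt_accum ^^ Suc i) (\<lambda>k. (-1) ^ k * real k * merge_weight q k) j / real j) k"
    using alt_accum_def[of "(alt_accum ^^ Suc i) (\<lambda>k. (-1) ^ k * real k * merge_weight q k)" k]
    by (simp only: funpow.simps(2) o_apply)
  also have "accum (\<lambda>j. (-1) ^ j * (alt_accum ^^ Suc i) (\<lambda>k. (-1) ^ k * real k * merge_weight q k) j / real j) k
      = accum (merge_weight (replicate (Suc i) 1 @ q)) k"
  proof (rule accum_cong[OF Suc.prems])
    fix j :: nat assume "j \<ge> 1"
    then show "(-1) ^ j * (alt_accum ^^ Suc i) (\<lambda>k. (-1) ^ k * real k * merge_weight q k) j / real j
        = merge_weight (replicate (Suc i) 1 @ q) j"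
      unfolding Suc.IH[OF \<open>j \<ge> 1\<close>]
      using assms(1)
      by (simp add: sgn_pow_def mult.assoc[symmetric] flip: power_mult_distrib)
  qed
  finally show ?case .
qed

text \<open>
  On the right-hand side an entry \<open>c \<ge> 3\<close> also changes the first entry \<open>x\<close> of what follows it into
  \<open>oplus (-1) x\<close>. Here \<open>q\<close> is the index after this change; multiplying by \<open>(-1)^k * k\<close> undoes it, and
  gives a meaning to \<open>x = 0\<close> with a bar, which occurs for an empty final block of twos.
\<close>

definition represents_tail :: "int list \<Rightarrow> int list \<Rightarrow> bool" where
  "represents_tail q s \<longleftrightarrow> q \<noteq> [] \<and> represents (\<lambda>k. (-1) ^ k * real k * merge_weight q k) s"

lemma represents_tail_replicate_2: "represents_tail [2 * int t + 1] (replicate t 2)"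
proof -
  have "represents (\<lambda>k. 2 * (-1) ^ k / real k ^ (2 * t)) (replicate t 2)"
    using represents_replicate_2[OF represents_Nil, of t] by simp
  then show ?thesis
    unfolding represents_tail_def
    by (auto simp: sgn_pow_odd elim!: represents_cong)
qed

text \<open>Of the c - 2 applications of \<open>alt_accum\<close> the first creates no entry, hence
  c - 3 ones. The remaining sign, the factor 1/k^2 and the \<open>b\<close> twos form the barred
  entry.\<close>

lemma represents_block_ge_3:
  assumes "represents_tail q s" "c \<ge> 3"
  shows "represents (merge_weight (- (2 * int b + 2) # replicate (nat (c - 3)) 1 @ q))
           (replicate b 2 @ c # s)"
proof -
  define i where "i = nat (c - 3)"
  have c: "c = int (Suc i) + 2" using assms(2) by (simp add: i_def)
  have q: "q \<noteq> []" and r: "represents (\<lambda>k. (-1) ^ k * real k * merge_weight q k) s"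
    using assms by (auto simp: represents_tail_def)
  show ?thesis
    using represents_replicate_2[OF represents_Cons_ge_2[OF r, of "Suc i"], of b]
    unfolding c[symmetric] i_def[symmetric]
  proof (rule represents_cong)
    fix k :: nat assume "k \<ge> 1"
    have "merge_weight (- (2 * int b + 2) # replicate i 1 @ q) k
        = (-1) ^ k / real k ^ (2 * b + 2) * accum (merge_weight (replicate i 1 @ q)) k"
      using q by (simp only: merge_weight_Cons sgn_pow_bar_even append_is_Nil_conv simp_thms)
    with alt_accum_power_merge_weight[OF q \<open>k \<ge> 1\<close>, of i]
    show "(alt_accum ^^ Suc i) (\<lambda>k. (-1) ^ k * real k * merge_weight q k) k / (real k)\<^sup>2 / real k ^ (2 * b)
        = merge_weight (- (2 * int b + 2) # replicate i 1 @ q) k"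
      by (simp only: power2_eq_square power_add) simp
  qed
qed

lemma represents_block_1:
  assumes "represents (merge_weight q) s" "q \<noteq> []"
  shows "represents (merge_weight ((2 * int a + 1) # q)) (replicate a 2 @ 1 # s)"
proof -
  show ?thesis
    by (rule represents_cong[OF represents_replicate_2[OF represents_Cons_1[OF assms(1)], of a]])
       (use assms(2) in \<open>simp add: sgn_pow_odd\<close>)
qed

text \<open>The block of \<open>represents_block_1\<close> in the form needed when some
  \<open>c \<ge> 3\<close> precedes it: extracting \<open>(-1)^k * k\<close> turns 2a+1 into the
  barred 2a+2.\<close>

lemma represents_tail_block_1:
  assumes "represents (merge_weight q) s" "q \<noteq> []"
  shows "represents_tail (- (2 * int a + 2) # q) (replicate a 2 @ 1 # s)"
proof -
  show ?thesis
    unfolding represents_tail_def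
  proof (intro conjI represents_cong[OF represents_block_1[OF assms, of a]])
    fix k :: nat assume "k \<ge> 1"
    then show "merge_weight ((2 * int a + 1) # q) k
        = (-1) ^ k * real k * merge_weight (- (2 * int a + 2) # q) k"
      using assms(2)
      by (simp add: merge_weight_Cons sgn_pow_odd sgn_pow_bar_even mult.assoc[symmetric]
          del: merge_weight.simps minus_add_distrib flip: power_mult_distrib)
  qed simp
qed

section \<open>Assembling the blocks\<close>

text \<open>For part (i): every block from the second on follows some \<open>c j\<close>, so
  \<open>represents_tail\<close> is the invariant.\<close>

lemma represents_tail_concat:
  assumes "\<And>j. j \<in> set js \<Longrightarrow> c j \<ge> 3" "represents_tail q s"
  shows "represents_tail
      (concat (map (\<lambda>j. [- (2 * int (a j) + 2), - (2 * int (b j) + 2)]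
          @ replicate (nat (c j - 3)) 1) js) @ q)
      (concat (map (\<lambda>j. replicate (a j) 2 @ [1] @ replicate (b j) 2 @ [c j]) js) @ s)"
  using assms(1)
proof (induction js)
  case (Cons j js)
  from represents_tail_block_1[OF represents_block_ge_3[OF Cons.IH, of "c j" "b j"], of "a j"]
  show ?case using Cons.prems by simp
qed (use assms(2) in simp)

text \<open>For part (ii): what follows a block comes after an entry 1, so plain
  \<open>represents\<close> is the invariant.\<close>

lemma represents_concat:
  assumes "\<And>j. j \<in> set js \<Longrightarrow> c j \<ge> 3" "represents (merge_weight q) s" "q \<noteq> []"
  shows "represents (merge_weight
      (concat (map (\<lambda>j. [- (2 * int (b j) + 2)] @ replicate (nat (c j - 3)) 1
          @ [- (2 * int (a j) + 2)]) js) @ q))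
      (concat (map (\<lambda>j. replicate (b j) 2 @ [c j] @ replicate (a j) 2 @ [1]) js) @ s)"
  using assms(1)
proof (induction js)
  case (Cons j js)
  from represents_block_ge_3[OF represents_tail_block_1[OF Cons.IH, of "a j"], of "c j" "b j"]
  show ?case using Cons.prems assms(3) by (simp del: merge_weight.simps)
qed (use assms(2) in simp)

lemma mhs_star_eq_sum_merge_set:
  assumes "represents (merge_weight q) s" "0 \<notin> set q" "q \<noteq> []" "n \<ge> 1"
  shows "mhs_star n s = - (\<Sum>p\<in>merge_set q. 2 ^ length p * binom_mhs n p)"
  using assms by (simp add: sum_merge_set_binom_mhs represents_def)

theorem theorem7p1:
  fixes r t n :: nat and a b :: "nat \<Rightarrow> nat" and c :: "nat \<Rightarrow> int"
  assumes "r \<ge> 1" and "n \<ge> 1" and "\<And>j. j \<ge> 1 \<Longrightarrow> c j \<ge> 3"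
  shows
    "(mhs_star n
       (concat (map (\<lambda>j. replicate (a j) 2 @ [1] @ replicate (b j) 2 @ [c j]) [1..<r + 1])
        @ replicate t 2)
     = - (\<Sum>p \<in> merge_set
            ([2 * int (a 1) + 1, - (2 * int (b 1) + 2)] @ replicate (nat (c 1 - 3)) 1
             @ concat (map (\<lambda>j. [- (2 * int (a j) + 2), - (2 * int (b j) + 2)]
                                 @ replicate (nat (c j - 3)) 1) [2..<r + 1])
             @ [2 * int t + 1]).
            2 ^ length p * binom_mhs n p))
     \<and>
     (mhs_star n
       (concat (map (\<lambda>j. replicate (b j) 2 @ [c j] @ replicate (a j) 2 @ [1]) [1..<r + 1])
        @ replicate (b (r + 1)) 2 @ [c (r + 1)] @ replicate t 2)
     = - (\<Sum>p \<in> merge_set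
            (concat (map (\<lambda>j. [- (2 * int (b j) + 2)] @ replicate (nat (c j - 3)) 1
                                 @ [- (2 * int (a j) + 2)]) [1..<r + 1])
             @ [- (2 * int (b (r + 1)) + 2)] @ replicate (nat (c (r + 1) - 3)) 1
             @ [2 * int t + 1]).
            2 ^ length p * binom_mhs n p))"
\<comment> \<open>Each part gives four goals; 1 and 5 are the representations, the others are side
  conditions.\<close>
proof (intro conjI mhs_star_eq_sum_merge_set, goal_cases)
  case 1
  \<comment> \<open>No \<open>c\<close> precedes the first block, so its leading entry stays 2a+1
    and it is treated separately.\<close>
  have "[1..<r + 1] = 1 # [2..<r + 1]"
    using assms(1) by (simp add: upt_conv_Cons numeral_2_eq_2 del: upt_Suc)
  moreover have "represents_tail
      (concat (map (\<lambda>j. [- (2 * int (a j) + 2), - (2 * int (b j) + 2)]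
          @ replicate (nat (c j - 3)) 1) [2..<r + 1]) @ [2 * int t + 1])
      (concat (map (\<lambda>j. replicate (a j) 2 @ [1] @ replicate (b j) 2 @ [c j]) [2..<r + 1])
        @ replicate t 2)"
    by (rule represents_tail_concat[OF _ represents_tail_replicate_2]) (auto intro: assms(3))
  from represents_block_1[OF represents_block_ge_3[OF this, of "c 1" "b 1"], of "a 1"]
  have "represents (merge_weight ((2 * int (a 1) + 1) # - (2 * int (b 1) + 2)
      # replicate (nat (c 1 - 3)) 1 @
      (concat (map (\<lambda>j. [- (2 * int (a j) + 2), - (2 * int (b j) + 2)]
          @ replicate (nat (c j - 3)) 1) [2..<r + 1]) @ [2 * int t + 1])))
      (replicate (a 1) 2 @ 1 # replicate (b 1) 2 @ c 1 #
      (concat (map (\<lambda>j. replicate (a j) 2 @ [1] @ replicate (b j) 2 @ [c j]) [2..<r + 1])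
        @ replicate t 2))"
    using assms(3) by simp
  ultimately show ?case
    by (simp only: list.map concat.simps append.simps append_assoc)
next
  case 5
  have "represents (merge_weight (- (2 * int (b (r + 1)) + 2)
      # replicate (nat (c (r + 1) - 3)) 1 @ [2 * int t + 1]))
      (replicate (b (r + 1)) 2 @ c (r + 1) # replicate t 2)"
    by (rule represents_block_ge_3[OF represents_tail_replicate_2]) (auto intro: assms(3))
  from represents_concat[OF _ this, of "[1..<r + 1]" c b a]
  show ?case using assms(3) by (simp del: upt_Suc)
qed (use assms(2) in auto)

end
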